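(* Let $T \in T(n,\Delta)$ be a tree containing a vertex $\rho$ of degree $\Delta$. If there is a vertex of $T$, different from $\rho$, whose degree is at least three, then there exists a tree $T' \in T(n,\Delta)$ such that \[ e^{HM_1(T)} > e^{HM_1(T')} \quad\text{and}\quad e^{HM_2(T)} > e^{HM_2(T')}. \]
   Context: All graphs are finite and simple. $T(n,\Delta)$ denotes the collection of all trees with $n$ vertices and maximum degree (exactly) $\Delta$. For a graph $G$ with edge set $E(G)$, where $\deg(v)$ denotes the degree of the vertex $v$ in $G$, the first and second hyper-Zagreb indices are \[ HM_1(G) = \sum_{\{u,v\}\in E(G)} \left(\deg(u)+\deg(v)\right)^2, \qquad HM_2(G) = \sum_{\{u,v\}\in E(G)} \left(\deg(u)\cdot\deg(v)\right)^2 . \] The exponential forms $e^{HM_1(G)}$ and $e^{HM_2(G)}$ are the real exponential function evaluated at these numbers. *)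

theory Defs
  imports Complex_Main
begin

record 'a graph =
  verts :: "'a set"
  edges :: "'a set set"

text \<open>Finite simple graphs: an edge is an unordered pair of distinct vertices.\<close>

definition simple_graph :: "'a graph \<Rightarrow> bool" where
  "simple_graph G \<longleftrightarrow>
     finite (verts G) \<and> (\<forall>e \<in> edges G. e \<subseteq> verts G \<and> card e = 2)"

definition degree :: "'a graph \<Rightarrow> 'a \<Rightarrow> nat" where
  "degree G v = card {e \<in> edges G. v \<in> e}"

definition connected_graph :: "'a graph \<Rightarrow> bool" where
  "connected_graph G \<longleftrightarrow>
     verts G \<noteq> {} \<and>
     (\<forall>u \<in> verts G. \<forall>v \<in> verts G. (u, v) \<in> {(x, y). {x, y} \<in> edges G}\<^sup>*)"

text \<open>A cycle is given by its list of vertices, the first one not being repeated at the end.\<close>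

definition is_cycle :: "'a graph \<Rightarrow> 'a list \<Rightarrow> bool" where
  "is_cycle G c \<longleftrightarrow>
     length c \<ge> 3 \<and> distinct c \<and>
     (\<forall>i. Suc i < length c \<longrightarrow> {c ! i, c ! Suc i} \<in> edges G) \<and>
     {last c, hd c} \<in> edges G"

definition is_tree :: "'a graph \<Rightarrow> bool" where
  "is_tree G \<longleftrightarrow> simple_graph G \<and> connected_graph G \<and> (\<nexists>c. is_cycle G c)"

definition max_degree :: "'a graph \<Rightarrow> nat" where
  "max_degree G = Max (degree G ` verts G)"

text \<open>The class \<open>T(n, \<Delta>)\<close>, with vertices drawn from the type \<open>'a\<close>.\<close>

definition trees :: "nat \<Rightarrow> nat \<Rightarrow> 'a graph set" where
  "trees n \<Delta> = {G. is_tree G \<and> card (verts G) = n \<and> max_degree G = \<Delta>}"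

text \<open>
  For an edge \<open>e = {u, v}\<close> with \<open>u \<noteq> v\<close>, the sum and the product over \<open>e\<close> below are
  \<open>deg u + deg v\<close> and \<open>deg u \<cdot> deg v\<close>.
\<close>

definition HM1 :: "'a graph \<Rightarrow> nat" where
  "HM1 G = (\<Sum>e \<in> edges G. (\<Sum>v \<in> e. degree G v)\<^sup>2)"

definition HM2 :: "'a graph \<Rightarrow> nat" where
  "HM2 G = (\<Sum>e \<in> edges G. (\<Prod>v \<in> e. degree G v)\<^sup>2)"

end

theory Submission
  imports Defs
begin

text \<open>
  Let \<open>w\<close> be the end of a longest path starting at \<open>\<rho>\<close>; it is a leaf, and its neighbour \<open>p\<close> is not
  \<open>\<rho>\<close>. Put \<open>v = p\<close> if \<open>deg p \<ge> 3\<close>; otherwise \<open>deg p \<le> 2\<close> and \<open>v\<close> is any vertex other than \<open>\<rho>\<close> of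
  degree at least three. Take a neighbour \<open>u\<close> of \<open>v\<close> that does not lie towards \<open>w\<close> and replace the
  edge \<open>vu\<close> by \<open>wu\<close>. Only the degrees of \<open>v\<close> and \<open>w\<close> change, to \<open>deg v - 1\<close> and \<open>2\<close>. The only edge
  whose contribution may grow is \<open>pw\<close>, and this growth is outweighed by the loss at the other
  edges of \<open>v\<close>.
\<close>

section \<open>Reachability and bridges\<close>

text \<open>Takes a bare edge set, so that edges can be deleted and added without forming a new
  graph.\<close>

definition reach :: "'a set set \<Rightarrow> ('a \<times> 'a) set" where
  "reach E = {(x, y). {x, y} \<in> E}\<^sup>*"

lemma reach_refl [simp]: "(x, x) \<in> reach E"
  by (simp add: reach_def)

lemma reach_edge: "{x, y} \<in> E \<Longrightarrow> (x, y) \<in> reach E"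
  by (auto simp: reach_def)

lemma reach_trans: "(x, y) \<in> reach E \<Longrightarrow> (y, z) \<in> reach E \<Longrightarrow> (x, z) \<in> reach E"
  by (simp add: reach_def)

lemma reach_sym: "(x, y) \<in> reach E \<Longrightarrow> (y, x) \<in> reach E"
  unfolding reach_def
  by (rule symD[OF sym_rtrancl]) (auto simp: sym_def insert_commute)

lemma reach_mono: "E \<subseteq> F \<Longrightarrow> (x, y) \<in> reach E \<Longrightarrow> (x, y) \<in> reach F"
  unfolding reach_def by (rule rtrancl_mono[THEN subsetD]) auto

lemma reach_induct [consumes 1, case_names refl step]:
  assumes "(x, y) \<in> reach E" and "P x"
    and "\<And>y z. (x, y) \<in> reach E \<Longrightarrow> {y, z} \<in> E \<Longrightarrow> P y \<Longrightarrow> P z"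
  shows "P y"
  using assms(1) unfolding reach_def
  by (induction rule: rtrancl_induct) (auto intro: assms(2,3) simp: reach_def)

text \<open>A walk needs the new edge at most once: crossing it back leads to an end already reached
  within \<open>E\<close>.\<close>

lemma reach_insertD:
  assumes "(a, b) \<in> reach (insert {x, y} E)"
  shows "(a, b) \<in> reach E \<or> (a, x) \<in> reach E \<and> (y, b) \<in> reach E
    \<or> (a, y) \<in> reach E \<and> (x, b) \<in> reach E"
  using assms
proof (induction rule: reach_induct)
  case refl
  then show ?case by simp
next
  case (step b c)
  show ?case
  proof (cases "{b, c} \<in> E")
    case True
    then show ?thesis using step.IH reach_trans reach_edge by metis
  next
    case False
    then have "b = x \<and> c = y \<or> b = y \<and> c = x"
      using step.hyps by (auto simp: doubleton_eq_iff)
    then show ?thesis using step.IH by auto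
  qed
qed

text \<open>Cut the walk after its last visit to \<open>v\<close>; the induction starts afresh at
  every departure from \<open>v\<close>.\<close>

lemma reach_first_step:
  assumes "(v, w) \<in> reach E" and "v \<noteq> w"
  obtains x where "{v, x} \<in> E" and "(x, w) \<in> reach {e \<in> E. v \<notin> e}"
proof -
  have "w = v \<or> (\<exists>x. {v, x} \<in> E \<and> (x, w) \<in> reach {e \<in> E. v \<notin> e})"
    using assms(1)
  proof (induction rule: reach_induct)
    case refl
    then show ?case by simp
  next
    case (step y z)
    consider "z = v" | "y = v" | "y \<noteq> v" "z \<noteq> v" by blast
    then show ?case
    proof cases
      case 2
      then have "{v, z} \<in> E \<and> (z, z) \<in> reach {e \<in> E. v \<notin> e}" using step.hyps by simp
      then show ?thesis by blast
    next
      case 3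
      then have "(y, z) \<in> reach {e \<in> E. v \<notin> e}" using step.hyps by (simp add: reach_edge)
      moreover obtain x where "{v, x} \<in> E" "(x, y) \<in> reach {e \<in> E. v \<notin> e}"
        using step.IH 3 by blast
      ultimately show ?thesis using reach_trans by fast
    qed simp
  qed
  then show ?thesis using that assms(2) by blast
qed

text \<open>Acyclicity in the form "every edge is a bridge", which suits edge exchanges better than
  cycles as vertex lists.\<close>

definition forest :: "'a set set \<Rightarrow> bool" where
  "forest E \<longleftrightarrow> (\<forall>x y. {x, y} \<in> E \<longrightarrow> (x, y) \<notin> reach (E - {{x, y}}))"

lemma forest_subset:
  assumes "forest E" and "F \<subseteq> E"
  shows "forest F"
  unfolding forest_def
proof (intro allI impI)
  fix x y assume "{x, y} \<in> F"
  then have "(x, y) \<notin> reach (E - {{x, y}})" using assms by (auto simp: forest_def)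
  moreover have "F - {{x, y}} \<subseteq> E - {{x, y}}" using assms(2) by blast
  ultimately show "(x, y) \<notin> reach (F - {{x, y}})"
    using reach_mono[of "F - {{x, y}}" "E - {{x, y}}" x y] by blast
qed

text \<open>A detour around an old edge \<open>ab\<close> must use the new edge \<open>xy\<close>;
  its two remaining pieces together with \<open>ab\<close> would already connect \<open>x\<close> to
  \<open>y\<close>.\<close>

lemma forest_insert:
  assumes F: "forest F" and xy: "(x, y) \<notin> reach F"
  shows "forest (insert {x, y} F)"
  unfolding forest_def
proof (intro allI impI notI)
  fix a b
  assume ab: "{a, b} \<in> insert {x, y} F"
    and r: "(a, b) \<in> reach (insert {x, y} F - {{a, b}})"
  show False
  proof (cases "{a, b} = {x, y}")
    case True
    have "(a, b) \<in> reach F" by (rule reach_mono[OF _ r]) (use True in auto)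
    then show False using True xy reach_sym[of a b F] by (auto simp: doubleton_eq_iff)
  next
    case False
    define H where "H = F - {{a, b}}"
    have "insert {x, y} F - {{a, b}} = insert {x, y} H"
      using False by (auto simp: H_def)
    moreover have "(a, b) \<notin> reach H"
      using F ab False unfolding forest_def H_def by auto
    ultimately have "(a, x) \<in> reach H \<and> (y, b) \<in> reach H \<or> (a, y) \<in> reach H \<and> (x, b) \<in> reach H"
      using reach_insertD[of a b x y H] r by simp
    then have "(a, x) \<in> reach F \<and> (y, b) \<in> reach F \<or> (a, y) \<in> reach F \<and> (x, b) \<in> reach F"
      using reach_mono[of H F] unfolding H_def by blast
    moreover have "(a, b) \<in> reach F" using ab False by (auto intro: reach_edge)
    ultimately have "(x, y) \<in> reach F" by (blast intro: reach_trans dest: reach_sym)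
    then show False using xy by simp
  qed
qed

section \<open>Paths and cycles\<close>

definition is_path :: "'a set set \<Rightarrow> 'a list \<Rightarrow> bool" where
  "is_path E c \<longleftrightarrow> c \<noteq> [] \<and> distinct c \<and> (\<forall>i. Suc i < length c \<longrightarrow> {c ! i, c ! Suc i} \<in> E)"

lemma is_path_snoc:
  assumes "is_path E c" and "{last c, z} \<in> E" and "z \<notin> set c"
  shows "is_path E (c @ [z])"
  unfolding is_path_def
proof (intro conjI allI impI)
  show "distinct (c @ [z])" using assms(1,3) by (simp add: is_path_def)
next
  fix i assume i: "Suc i < length (c @ [z])"
  show "{(c @ [z]) ! i, (c @ [z]) ! Suc i} \<in> E"
  proof (cases "Suc i < length c")
    case True
    then show ?thesis using assms(1) by (auto simp: is_path_def nth_append)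
  next
    case False
    then have "Suc i = length c" using i by simp
    moreover from this have "last c = c ! i"
      by (metis Zero_not_Suc diff_Suc_1 last_conv_nth list.size(3))
    ultimately show ?thesis using assms(2) by (auto simp: nth_append)
  qed
qed simp

lemma reach_imp_path:
  assumes "(x, y) \<in> reach E"
  shows "\<exists>c. is_path E c \<and> hd c = x \<and> last c = y"
  using assms
proof (induction rule: reach_induct)
  case refl
  have "is_path E [x]" by (simp add: is_path_def)
  then show ?case by (metis last_ConsL list.sel(1))
next
  case (step y z)
  then obtain c where c: "is_path E c" "hd c = x" "last c = y" by blast
  show ?case
  proof (cases "z \<in> set c")
    case True
    then obtain i where i: "i < length c" "c ! i = z" by (auto simp: in_set_conv_nth)
    \<comment> \<open>When \<open>z\<close> already lies on the path, the path is cut off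
      there.\<close>
    have "is_path E (take (Suc i) c)"
      using c i by (auto simp: is_path_def)
    moreover have "hd (take (Suc i) c) = x" using c by (simp add: is_path_def)
    moreover have "last (take (Suc i) c) = z"
      using i by (simp add: take_Suc_conv_app_nth)
    ultimately show ?thesis by blast
  next
    case False
    then have "is_path E (c @ [z])" using is_path_snoc[OF c(1)] c(3) step.hyps by simp
    moreover have "hd (c @ [z]) = x" using c by (simp add: is_path_def)
    ultimately show ?thesis by (metis last_snoc)
  qed
qed

lemma simple_graph_edgeE:
  assumes "simple_graph G" and "e \<in> edges G"
  obtains x y where "e = {x, y}" and "x \<noteq> y"
  using assms by (auto simp: simple_graph_def card_2_iff)

lemma simple_graph_finite_edges: "simple_graph G \<Longrightarrow> finite (edges G)"
  by (rule finite_subset[of _ "Pow (verts G)"]) (auto simp: simple_graph_def)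

text \<open>A detour around an edge can be taken as a path, and the edge closes it to a cycle. A
  detour with two vertices would be the deleted edge itself.\<close>

lemma no_cycle_imp_forest:
  assumes "simple_graph G" and no: "\<nexists>c. is_cycle G c"
  shows "forest (edges G)"
  unfolding forest_def
proof (intro allI impI notI)
  fix x y
  assume xy: "{x, y} \<in> edges G" and "(x, y) \<in> reach (edges G - {{x, y}})"
  then obtain c where c: "is_path (edges G - {{x, y}}) c" "hd c = x" "last c = y"
    using reach_imp_path by metis
  have "card {x, y} = 2" using assms(1) xy by (simp add: simple_graph_def)
  then have ne: "x \<noteq> y" by auto
  have "length c \<ge> 3"
  proof (rule ccontr)
    assume "\<not> 3 \<le> length c"
    then consider "length c = 0" | "length c = 1" | "length c = 2" by linarith
    then show False
    proof cases
      case 2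
      then show False using c ne by (auto simp: length_Suc_conv)
    next
      case 3
      then have "c = [x, y]" using c by (auto simp: length_Suc_conv numeral_2_eq_2)
      then show False using c by (auto simp: is_path_def)
    qed (use c in \<open>auto simp: is_path_def\<close>)
  qed
  then have "is_cycle G c"
    using c xy by (auto simp: is_cycle_def is_path_def insert_commute)
  then show False using no by blast
qed

lemma path_reach:
  assumes "\<And>i. Suc i < length c \<Longrightarrow> {c ! i, c ! Suc i} \<in> E" and "j < length c"
  shows "(c ! 0, c ! j) \<in> reach E"
  using assms(2)
proof (induction j)
  case (Suc j)
  then show ?case using assms(1) reach_edge reach_trans Suc_lessD by metis
qed simp

text \<open>The rest of a cycle is a detour around its closing edge; length at least 3 keeps that
  edge distinct from the others.\<close>

lemma forest_imp_no_cycle: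
  assumes "forest (edges G)"
  shows "\<nexists>c. is_cycle G c"
proof
  assume "\<exists>c. is_cycle G c"
  then obtain c where c: "length c \<ge> 3" "distinct c" "{last c, hd c} \<in> edges G"
    "\<And>i. Suc i < length c \<Longrightarrow> {c ! i, c ! Suc i} \<in> edges G"
    by (auto simp: is_cycle_def)
  have ne: "c \<noteq> []" using c by auto
  have hl: "hd c = c ! 0" "last c = c ! (length c - 1)"
    using ne by (auto simp: hd_conv_nth last_conv_nth)
  have "(c ! 0, c ! (length c - 1)) \<in> reach (edges G - {{last c, hd c}})"
  proof (rule path_reach)
    fix i assume i: "Suc i < length c"
    have "{c ! i, c ! Suc i} \<noteq> {last c, hd c}"
      using c(1,2) i ne by (auto simp: hl doubleton_eq_iff nth_eq_iff_index_eq)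
    then show "{c ! i, c ! Suc i} \<in> edges G - {{last c, hd c}}" using c(4) i by simp
  qed (use ne in simp)
  then have "(last c, hd c) \<in> reach (edges G - {{last c, hd c}})"
    using reach_sym hl by metis
  then show False using assms c(3) by (simp add: forest_def)
qed

text \<open>Reduces the tree property to facts about the edge set that can be tracked through an
  exchange.\<close>

lemma is_tree_iff:
  "is_tree G \<longleftrightarrow> simple_graph G \<and> verts G \<noteq> {}
     \<and> (\<forall>a \<in> verts G. \<forall>b \<in> verts G. (a, b) \<in> reach (edges G)) \<and> forest (edges G)"
  unfolding is_tree_def connected_graph_def reach_def[symmetric]
  using no_cycle_imp_forest forest_imp_no_cycle by blast

section \<open>Neighbours, and a leaf whose neighbour is not the root\<close>

lemma edge_verts: "simple_graph G \<Longrightarrow> {x, y} \<in> edges G \<Longrightarrow> x \<in> verts G \<and> y \<in> verts G \<and> x \<noteq> y"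
  by (auto simp: simple_graph_def dest!: bspec[of _ _ "{x, y}"])

lemma incident_edgeE:
  assumes "simple_graph G" and "e \<in> edges G" and "v \<in> e"
  obtains x where "e = {v, x}" and "x \<noteq> v"
proof -
  obtain a b where "e = {a, b}" "a \<noteq> b" using simple_graph_edgeE assms by blast
  then show ?thesis using that[of a] that[of b] assms(3) by (auto simp: insert_commute)
qed

lemma other_neighbour:
  assumes "simple_graph G" and "degree G v \<ge> 2"
  obtains u where "{v, u} \<in> edges G" and "u \<noteq> x"
proof -
  have "\<not> {e \<in> edges G. v \<in> e} \<subseteq> {{v, x}}"
    using assms(2) card_mono[of "{{v, x}}" "{e \<in> edges G. v \<in> e}"] by (auto simp: degree_def)
  then obtain e where "e \<in> edges G" "v \<in> e" "e \<noteq> {v, x}" by blast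
  then show ?thesis using incident_edgeE[OF assms(1)] that by metis
qed

lemma exists_far_leaf:
  assumes tree: "is_tree T" and \<rho>: "\<rho> \<in> verts T"
    and v: "v \<in> verts T" "v \<noteq> \<rho>" "degree T v \<ge> 2"
  obtains p w where "{p, w} \<in> edges T" and "p \<noteq> \<rho>" and "w \<noteq> \<rho>" and "degree T w = 1"
proof -
  have sg: "simple_graph T" and fin: "finite (verts T)" and no: "\<nexists>c. is_cycle T c"
    using tree by (auto simp: is_tree_def simple_graph_def)
  let ?P = "\<lambda>c. is_path (edges T) c \<and> hd c = \<rho>"
  have bound: "length c \<le> card (verts T)" if c: "?P c" for c
  proof -
    have "c ! i \<in> verts T" if "i < length c" for i
    proof (cases i)
      case 0
      then show ?thesis using c \<rho> hd_conv_nth[of c] unfolding is_path_def by metis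
    next
      case (Suc j)
      then have "{c ! j, c ! Suc j} \<in> edges T" using c that by (simp add: is_path_def)
      then show ?thesis using edge_verts[OF sg] Suc by blast
    qed
    then have "set c \<subseteq> verts T" by (auto simp: in_set_conv_nth)
    then have "card (set c) \<le> card (verts T)" using fin card_mono by blast
    then show ?thesis using c by (simp add: is_path_def distinct_card)
  qed
  have "(\<rho>, v) \<in> reach (edges T)" using tree \<rho> v by (simp add: is_tree_iff)
  then obtain q where q: "?P q" "last q = v" using reach_imp_path by metis
  \<comment> \<open>Three vertices separate the last but one from \<open>\<rho>\<close>. If
    \<open>v\<close> is adjacent to \<open>\<rho>\<close> on \<open>q\<close>, a second neighbour of
    \<open>v\<close> prolongs \<open>q\<close>.\<close>
  have long: "\<exists>c. ?P c \<and> length c \<ge> 3"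
  proof (cases "length q \<ge> 3")
    case True
    then show ?thesis using q by blast
  next
    case False
    then consider "length q = 0" | "length q = 1" | "length q = 2" by linarith
    then have "q = [\<rho>, v]"
      using q v by cases (auto simp: length_Suc_conv numeral_2_eq_2 is_path_def)
    moreover obtain y where "{v, y} \<in> edges T" "y \<noteq> \<rho>"
      using other_neighbour[OF sg v(3)] by metis
    ultimately have "?P (q @ [y])"
      using q edge_verts[OF sg] by (intro conjI is_path_snoc) auto
    moreover have "length (q @ [y]) \<ge> 3" using \<open>q = [\<rho>, v]\<close> by simp
    ultimately show ?thesis by blast
  qed
  obtain c where c: "?P c" and max: "\<And>d. ?P d \<Longrightarrow> length d \<le> length c"
    using ex_has_greatest_nat[of ?P q length "Suc (card (verts T))"] bound q(1)
    by (auto simp: less_Suc_eq_le)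
  have len: "length c \<ge> 3" using long max le_trans by blast
  define p w where "p = c ! (length c - 2)" and "w = c ! (length c - 1)"
  have dist: "distinct c" and ne: "c \<noteq> []" and steps: "\<And>i. Suc i < length c \<Longrightarrow> {c ! i, c ! Suc i} \<in> edges T"
    using c by (auto simp: is_path_def)
  have last: "last c = w" using ne by (simp add: w_def last_conv_nth)
  have r: "\<rho> = c ! 0" using c ne by (simp add: hd_conv_nth)
  have "Suc (length c - 2) = length c - 1" using len by simp
  then have pw: "{p, w} \<in> edges T" using steps[of "length c - 2"] len by (simp add: p_def w_def)
  have "p \<noteq> \<rho>" "w \<noteq> \<rho>"
    using dist len ne by (auto simp: p_def w_def r nth_eq_iff_index_eq)
  moreover have "{e \<in> edges T. w \<in> e} = {{p, w}}"
  proof -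
    have "y = p" if y: "{w, y} \<in> edges T" for y
    proof -
      \<comment> \<open>A neighbour of \<open>w\<close> off the path would prolong it, against
        maximality.\<close>
      have "y \<in> set c"
      proof (rule ccontr)
        assume "y \<notin> set c"
        then have "?P (c @ [y])" using is_path_snoc c y last ne by fastforce
        then show False using max by fastforce
      qed
      then obtain i where i: "i < length c" "c ! i = y" by (auto simp: in_set_conv_nth)
      \<comment> \<open>This bound says that \<open>drop i c\<close> has at least three vertices,
        enough for the edge \<open>wy\<close> to close a cycle. Only the positions of
        \<open>p\<close> and \<open>w\<close> remain.\<close>
      have "\<not> i + 3 \<le> length c"
      proof
        assume "i + 3 \<le> length c"
        then have "is_cycle T (drop i c)"
          using dist steps y i last by (auto simp: is_cycle_def hd_drop_conv_nth)
        then show False using no by blast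
      qed
      moreover have "i \<noteq> length c - 1" using y i edge_verts[OF sg] w_def by metis
      ultimately have "i = length c - 2" using i by linarith
      then show ?thesis using i p_def by simp
    qed
    then have "e = {p, w}" if "e \<in> edges T" "w \<in> e" for e
      using incident_edgeE[OF sg that] that(1) by (metis insert_commute)
    then show ?thesis using pw by blast
  qed
  then have "degree T w = 1" by (simp add: degree_def)
  ultimately show ?thesis using that pw by blast
qed

section \<open>Moving an edge to a leaf\<close>

lemma card_incident_insert:
  assumes "finite H" and "e \<notin> H"
  shows "card {f \<in> insert e H. z \<in> f} = card {f \<in> H. z \<in> f} + of_bool (z \<in> e)"
proof (cases "z \<in> e")
  case True
  then have "{f \<in> insert e H. z \<in> f} = insert e {f \<in> H. z \<in> f}" by auto
  then show ?thesis using assms True by simp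
next
  case False
  then have "{f \<in> insert e H. z \<in> f} = {f \<in> H. z \<in> f}" by auto
  then show ?thesis using False by simp
qed

definition move_edge :: "'a graph \<Rightarrow> 'a \<Rightarrow> 'a \<Rightarrow> 'a \<Rightarrow> 'a graph" where
  "move_edge G u v w = \<lparr>verts = verts G, edges = insert {w, u} (edges G - {{v, u}})\<rparr>"

lemma degree_move_edge:
  assumes "simple_graph G" and "{v, u} \<in> edges G" and "{w, u} \<notin> edges G" and "w \<noteq> u"
  shows "degree (move_edge G u v w) z
    = (if z = v then degree G z - 1 else if z = w then degree G z + 1 else degree G z)"
proof -
  \<comment> \<open>Both graphs add one edge to \<open>H\<close>; \<open>u\<close> lies on both
    added edges, so its degree is kept.\<close>
  define H where "H = edges G - {{v, u}}"
  have fin: "finite H" and E: "edges G = insert {v, u} H"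
    using simple_graph_finite_edges[OF assms(1)] assms(2) by (auto simp: H_def)
  have "{v, u} \<notin> H" "{w, u} \<notin> H" using assms(3) by (auto simp: H_def)
  then have "degree G z = card {f \<in> H. z \<in> f} + of_bool (z \<in> {v, u})"
    and "degree (move_edge G u v w) z = card {f \<in> H. z \<in> f} + of_bool (z \<in> {w, u})"
    using card_incident_insert[OF fin] by (simp_all add: degree_def E move_edge_def)
  moreover have "v \<noteq> u" "v \<noteq> w" using edge_verts[OF assms(1,2)] assms(2,3) by auto
  ultimately show ?thesis using assms(4) by auto
qed

lemma reach_subst:
  assumes "(a, b) \<in> reach E" and "\<And>x y. {x, y} \<in> E \<Longrightarrow> (x, y) \<in> reach E'"
  shows "(a, b) \<in> reach E'"
  using assms(1)
proof (induction rule: reach_induct)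
  case (step y z)
  then show ?case using reach_trans[of a y E' z] assms(2) by simp
qed simp

text \<open>Deleting the bridge \<open>vu\<close> leaves two sides. By \<open>vw\<close>,
  \<open>w\<close> is on the side of \<open>v\<close>, so \<open>wu\<close> rejoins the sides
  without creating a cycle.\<close>

lemma is_tree_move_edge:
  assumes tree: "is_tree G" and vu: "{v, u} \<in> edges G" and w: "w \<in> verts G" "w \<noteq> v"
    and vw: "(v, w) \<in> reach (edges G - {{v, u}})"
  shows "is_tree (move_edge G u v w)" and "{w, u} \<notin> edges G" and "w \<noteq> u"
proof -
  define H where "H = edges G - {{v, u}}"
  have sg: "simple_graph G" and forest: "forest (edges G)" using tree by (auto simp: is_tree_iff)
  have vwH: "(v, w) \<in> reach H" using vw by (simp add: H_def)
  have "(v, u) \<notin> reach H" using forest vu by (simp add: forest_def H_def)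
  then have wu: "(w, u) \<notin> reach H" using vwH reach_trans[of v w H u] by blast
  then show ne: "w \<noteq> u" by auto
  show "{w, u} \<notin> edges G"
    using wu reach_edge[of w u H] w(2) by (auto simp: H_def doubleton_eq_iff)
  have E': "edges (move_edge G u v w) = insert {w, u} H"
    by (simp add: move_edge_def H_def)
  \<comment> \<open>The lost edge is replaced by the walk from \<open>v\<close> to \<open>w\<close>
    and then to \<open>u\<close>.\<close>
  have "(v, u) \<in> reach (insert {w, u} H)"
  proof (rule reach_trans)
    show "(v, w) \<in> reach (insert {w, u} H)" by (rule reach_mono[OF _ vwH]) blast
    show "(w, u) \<in> reach (insert {w, u} H)" by (simp add: reach_edge)
  qed
  then have edge: "(x, y) \<in> reach (insert {w, u} H)" if "{x, y} \<in> edges G" for x y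
  proof (cases "{x, y} = {v, u}")
    case True
    then show ?thesis
      using \<open>(v, u) \<in> reach (insert {w, u} H)\<close> reach_sym[of v u "insert {w, u} H"]
      by (auto simp: doubleton_eq_iff)
  next
    case False
    then show ?thesis using that by (simp add: reach_edge H_def)
  qed
  have "forest (insert {w, u} H)"
    by (rule forest_insert[OF forest_subset[OF forest] wu]) (auto simp: H_def)
  moreover have "simple_graph (move_edge G u v w)"
    using sg edge_verts[OF sg vu] w(1) ne by (auto simp: simple_graph_def move_edge_def)
  moreover have "verts (move_edge G u v w) = verts G" by (simp add: move_edge_def)
  ultimately show "is_tree (move_edge G u v w)"
    using tree edge reach_subst[of _ _ "edges G" "insert {w, u} H"]
    unfolding is_tree_iff E' by simp
qed

text \<open>
  \<open>g_centre\<close> (the case \<open>p = v\<close>, \<open>deg v = j + 2\<close>) and \<open>g_path\<close> (the case \<open>deg p \<le> 2\<close>) bound the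
  growth at the edge \<open>pw\<close>; by \<open>g_mono\<close>, the moved edge loses at least \<open>(deg v)\<^sup>2 - 4\<close> and every other
  edge at \<open>v\<close> at least \<open>2 deg v - 1\<close>. Equality holds in \<open>g_centre\<close> for \<open>g x y = (x y)\<^sup>2\<close>, and in
  \<open>g_path\<close> for this \<open>g\<close> at \<open>x = 2\<close>.
\<close>

lemma edge_sum_move_edge_less:
  fixes F :: "('a \<Rightarrow> nat) \<Rightarrow> 'a set \<Rightarrow> nat" and g :: "nat \<Rightarrow> nat \<Rightarrow> nat"
  assumes F: "\<And>d x y. x \<noteq> y \<Longrightarrow> F d {x, y} = g (d x) (d y)"
    and g_mono: "\<And>i k x. i \<le> k \<Longrightarrow> x \<ge> 1 \<Longrightarrow> g i x + k\<^sup>2 \<le> g k x + i\<^sup>2"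
    and g_centre: "\<And>j. g (Suc j) 2 \<le> g (Suc (Suc j)) 1 + (3 * j + 4) * j"
    and g_path: "\<And>x. x \<le> 2 \<Longrightarrow> g x 2 \<le> g x 1 + 12"
    and sg: "simple_graph G"
    and vu: "{v, u} \<in> edges G" and pw: "{p, w} \<in> edges G" and wu: "{w, u} \<notin> edges G"
    and ne: "w \<noteq> u" "v \<noteq> w"
    and v: "degree G v \<ge> 3" and w: "degree G w = 1" and p: "p = v \<or> degree G p \<le> 2"
  defines "G' \<equiv> move_edge G u v w"
  shows "(\<Sum>e \<in> edges G'. F (degree G') e) < (\<Sum>e \<in> edges G. F (degree G) e)"
proof -
  define d d' where "d = degree G" and "d' = degree G'"
  define H where "H = edges G - {{v, u}}"
  \<comment> \<open>Apart from \<open>vu\<close> and \<open>pw\<close>, the edges in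
    \<open>B\<close> meet \<open>v\<close> and lose weight, while those in \<open>C\<close> keep
    theirs.\<close>
  define B C where "B = {e \<in> H - {{p, w}}. v \<in> e}" and "C = {e \<in> H - {{p, w}}. v \<notin> e}"
  have fin: "finite H" using simple_graph_finite_edges[OF sg] by (simp add: H_def)
  have d': "d' z = (if z = v then d z - 1 else if z = w then d z + 1 else d z)" for z
    using degree_move_edge[OF sg vu wu ne(1)] by (simp add: d_def d'_def G'_def)
  have vu_ne: "v \<noteq> u" and pw_ne: "p \<noteq> w" using edge_verts[OF sg] vu pw by auto
  have E: "edges G = insert {v, u} H" "{v, u} \<notin> H"
    and E': "edges G' = insert {w, u} H" "{w, u} \<notin> H"
    using vu wu by (auto simp: H_def G'_def move_edge_def)
  have pwH: "{p, w} \<in> H" using pw ne by (auto simp: H_def doubleton_eq_iff)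
  obtain j where j: "d v = Suc (Suc j)" "j \<ge> 1"
    using that[of "d v - 2"] v by (simp add: d_def)
  have HBC: "H = insert {p, w} (B \<union> C)" "{p, w} \<notin> B \<union> C" "B \<inter> C = {}" "finite B" "finite C"
    using pwH fin by (auto simp: B_def C_def)
  \<comment> \<open>Without \<open>vu\<close>, \<open>deg v - 1 = j + 1\<close> edges remain at
    \<open>v\<close>; one of them is \<open>pw\<close> exactly when \<open>p = v\<close>.\<close>
  have "Suc j = card {e \<in> H. v \<in> e}"
    using card_incident_insert[OF fin E(2), of v] j by (simp add: d_def degree_def E(1))
  moreover have "{e \<in> H. v \<in> e} = (if p = v then insert {p, w} B else B)"
    using pwH ne(2) by (auto simp: B_def)
  ultimately have cardB: "card B = (if p = v then j else Suc j)"
    using HBC by (auto split: if_splits)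
  have leaf: "w \<notin> e" if e: "e \<in> B \<union> C" for e
  proof
    assume "w \<in> e"
    then have "{e, {p, w}} \<subseteq> {e \<in> edges G. w \<in> e}" using e pw by (auto simp: B_def C_def H_def)
    moreover have "finite {e \<in> edges G. w \<in> e}" using simple_graph_finite_edges[OF sg] by simp
    ultimately have "card {e, {p, w}} \<le> degree G w" unfolding degree_def by (intro card_mono)
    moreover have "e \<noteq> {p, w}" using e by (auto simp: B_def C_def)
    ultimately show False using w by simp
  qed
  have pos: "d x \<ge> 1" if "e \<in> edges G" "x \<in> e" for x e
    using that simple_graph_finite_edges[OF sg]
    by (auto simp: d_def degree_def Suc_le_eq card_gt_0_iff)
  have C: "sum (F d') C = sum (F d) C"
  proof (rule sum.cong[OF refl])
    fix e assume e: "e \<in> C"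
    then have "e \<in> edges G" by (simp add: C_def H_def)
    then obtain x y where xy: "e = {x, y}" "x \<noteq> y" using simple_graph_edgeE[OF sg] by blast
    have "w \<notin> e" "v \<notin> e" using e leaf by (simp_all add: C_def)
    then show "F d' e = F d e" using xy by (auto simp: F d')
  qed
  \<comment> \<open>With \<open>deg v = j + 2\<close>, the loss \<open>2 deg v - 1\<close> is
    \<open>2 * j + 3\<close>, and below \<open>(deg v)^2 - 4\<close> is
    \<open>j * j + 4 * j\<close>.\<close>
  have "F d' e + (2 * j + 3) \<le> F d e" if e: "e \<in> B" for e
  proof -
    have eE: "e \<in> edges G" "v \<in> e" using e by (auto simp: B_def H_def)
    then obtain x where x: "e = {v, x}" "x \<noteq> v" using incident_edgeE[OF sg] by blast
    have "w \<notin> e" using e leaf by simp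
    then have "d' x = d x" "d' v = Suc j" using x j by (auto simp: d')
    moreover have "d x \<ge> 1" using pos eE x by blast
    ultimately show ?thesis
      using g_mono[of "Suc j" "Suc (Suc j)" "d x"] x j(1)
      by (simp add: F power2_eq_square)
  qed
  then have "(\<Sum>e\<in>B. F d' e + (2 * j + 3)) \<le> sum (F d) B" by (rule sum_mono)
  then have B: "sum (F d') B + card B * (2 * j + 3) \<le> sum (F d) B"
    by (simp add: sum.distrib)
  have "d' u = d u" "d' w = 2" using vu_ne ne w by (auto simp: d' d_def)
  moreover have "d u \<ge> 1" using pos vu by blast
  ultimately have moved: "F d' {w, u} + j * j + 4 * j \<le> F d {v, u}"
    using g_mono[of 2 "Suc (Suc j)" "d u"] j ne(1) vu_ne
    by (simp add: F power2_eq_square)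
  have "d w = 1" using w by (simp add: d_def)
  have "F d' {w, u} + F d' {p, w} + sum (F d') B < F d {v, u} + F d {p, w} + sum (F d) B"
  proof (cases "p = v")
    case True
    then have "F d' {p, w} \<le> F d {p, w} + (3 * j + 4) * j"
      using g_centre[of j] pw_ne j d'[of v] \<open>d' w = 2\<close> \<open>d w = 1\<close> by (simp add: F)
    \<comment> \<open>The losses total at least \<open>j * (2 * j + 3) + j * j + 4 * j\<close>,
      exceeding the growth bound by \<open>3 * j > 0\<close>.\<close>
    then show ?thesis using moved B cardB True j(2) by (simp add: algebra_simps)
  next
    case False
    then have "F d' {p, w} \<le> F d {p, w} + 12"
      using g_path[of "d p"] p pw_ne d'[of p] \<open>d' w = 2\<close> \<open>d w = 1\<close> by (simp add: F d_def)
    moreover have "j * j \<ge> 1" using j(2) by simp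
    moreover have "sum (F d') B + (2 * (j * j) + 5 * j + 3) \<le> sum (F d) B"
      using B cardB False by (simp add: algebra_simps)
    \<comment> \<open>The losses total at least \<open>3 * j * j + 9 * j + 3\<close>, which is at
      least 15 and so beats 12.\<close>
    ultimately show ?thesis using moved j(2) by linarith
  qed
  moreover have "sum f (insert {p, w} (B \<union> C)) = f {p, w} + (sum f B + sum f C)" for f :: "'a set \<Rightarrow> nat"
    using HBC by (simp add: sum.union_disjoint)
  ultimately have "F d' {w, u} + sum (F d') H < F d {v, u} + sum (F d) H"
    using C HBC(1) by simp
  then show ?thesis using E E' fin by (simp add: d_def d'_def)
qed

section \<open>The exchange applied to both hyper-Zagreb indices\<close>

theorem proposition3p4:
  fixes T :: "'a graph" and n \<Delta> :: nat and \<rho> :: 'a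
  assumes "T \<in> trees n \<Delta>"
    and "\<rho> \<in> verts T" and "degree T \<rho> = \<Delta>"
    and "\<exists>v \<in> verts T. v \<noteq> \<rho> \<and> degree T v \<ge> 3"
  shows "\<exists>T' :: 'a graph. T' \<in> trees n \<Delta> \<and>
           exp (real (HM1 T)) > exp (real (HM1 T')) \<and>
           exp (real (HM2 T)) > exp (real (HM2 T'))"
proof -
  have tree: "is_tree T" and n: "card (verts T) = n" and \<Delta>: "max_degree T = \<Delta>"
    using assms(1) by (auto simp: trees_def)
  have sg: "simple_graph T" and fin: "finite (verts T)"
    using tree by (auto simp: is_tree_def simple_graph_def)
  obtain v0 where v0: "v0 \<in> verts T" "v0 \<noteq> \<rho>" "degree T v0 \<ge> 3" using assms(4) by blast
  then obtain p w where pw: "{p, w} \<in> edges T" "p \<noteq> \<rho>" "w \<noteq> \<rho>" "degree T w = 1"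
    using exists_far_leaf[OF tree assms(2), of v0] by auto
  have pwV: "p \<in> verts T" "w \<in> verts T" using edge_verts[OF sg pw(1)] by auto
  obtain v where v: "v \<in> verts T" "v \<noteq> \<rho>" "degree T v \<ge> 3" and p: "p = v \<or> degree T p \<le> 2"
  proof (cases "degree T p \<ge> 3")
    case True
    then show ?thesis using that[of p] pw pwV by simp
  next
    case False
    then show ?thesis using that[of v0] v0 by simp
  qed
  have vw: "w \<noteq> v" using v pw by auto
  have "(v, w) \<in> reach (edges T)" using tree v pwV by (simp add: is_tree_iff)
  \<comment> \<open>\<open>x\<close> is the neighbour of \<open>v\<close> towards \<open>w\<close>.
    The walk onwards avoids \<open>v\<close>, hence survives the deletion of \<open>vu\<close> for
    any other neighbour \<open>u\<close>.\<close>
  then obtain x where x: "{v, x} \<in> edges T" "(x, w) \<in> reach {e \<in> edges T. v \<notin> e}"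
    using reach_first_step vw by metis
  obtain u where u: "{v, u} \<in> edges T" "u \<noteq> x"
    using other_neighbour[OF sg, of v x] v(3) by auto
  define T' where "T' = move_edge T u v w"
  have "(v, x) \<in> reach (edges T - {{v, u}})"
    using x u by (intro reach_edge) (auto simp: doubleton_eq_iff)
  moreover have "(x, w) \<in> reach (edges T - {{v, u}})"
    by (rule reach_mono[OF _ x(2)]) auto
  ultimately have r: "(v, w) \<in> reach (edges T - {{v, u}})" by (rule reach_trans)
  note moved = is_tree_move_edge[OF tree u(1) pwV(2) vw r]
  have deg': "degree T' z = (if z = v then degree T z - 1 else if z = w then degree T z + 1 else degree T z)" for z
    unfolding T'_def using degree_move_edge[OF sg u(1) moved(2,3)] .
  have verts': "verts T' = verts T" by (simp add: T'_def move_edge_def)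
  have le: "degree T z \<le> \<Delta>" if "z \<in> verts T" for z
    using that fin \<Delta> by (auto simp: max_degree_def)
  have "max_degree T' = \<Delta>"
    unfolding max_degree_def verts'
  proof (rule Max_eqI)
    fix y assume "y \<in> degree T' ` verts T"
    \<comment> \<open>The only increased degree is that of \<open>w\<close>, now 2, which is below
      \<open>deg v \<le> \<Delta>\<close>; \<open>\<rho>\<close> differs from \<open>v\<close> and
      \<open>w\<close> and still attains \<open>\<Delta>\<close>.\<close>
    then show "y \<le> \<Delta>" using le le[OF v(1)] v(3) pw(4) by (auto simp: deg' intro: le_trans[OF diff_le_self])
  next
    have "degree T' \<rho> = \<Delta>" using v(2) pw(3) assms(3) by (simp add: deg')
    then show "\<Delta> \<in> degree T' ` verts T" using assms(2) by auto
  qed (use fin in simp)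
  then have "T' \<in> trees n \<Delta>"
    using moved(1) n verts' by (simp add: trees_def T'_def)
  moreover have "HM1 T' < HM1 T"
    unfolding HM1_def T'_def
  proof (rule edge_sum_move_edge_less[where g = "\<lambda>x y. (x + y)\<^sup>2" and F = "\<lambda>d e. (sum d e)\<^sup>2",
        OF _ _ _ _ sg u(1) pw(1) moved(2,3) vw[symmetric] v(3) pw(4) p])
    \<comment> \<open>Expanding the squares leaves only the mixed terms to compare.\<close>
    fix i k x :: nat assume "i \<le> k"
    then have "2 * i * x \<le> 2 * k * x" by simp
    then show "(i + x)\<^sup>2 + k\<^sup>2 \<le> (k + x)\<^sup>2 + i\<^sup>2"
      unfolding power2_sum by linarith
  next
    fix x :: nat assume "x \<le> 2"
    then show "(x + 2)\<^sup>2 \<le> (x + 1)\<^sup>2 + 12" by (simp add: power2_eq_square algebra_simps)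
  \<comment> \<open>For sums, \<open>g_centre\<close> holds because both values of \<open>g\<close>
    are \<open>(j + 3)^2\<close>.\<close>
  qed (simp_all add: power2_eq_square algebra_simps)
  moreover have "HM2 T' < HM2 T"
    unfolding HM2_def T'_def
  proof (rule edge_sum_move_edge_less[where g = "\<lambda>x y. (x * y)\<^sup>2" and F = "\<lambda>d e. (prod d e)\<^sup>2",
        OF _ _ _ _ sg u(1) pw(1) moved(2,3) vw[symmetric] v(3) pw(4) p])
    fix i k x :: nat assume "i \<le> k" "1 \<le> x"
    \<comment> \<open>Products scale the difference of squares by \<open>x^2 \<ge> 1\<close>; the
      two bounds that follow keep the natural subtractions exact.\<close>
    then have "(k\<^sup>2 - i\<^sup>2) * 1 \<le> (k\<^sup>2 - i\<^sup>2) * x\<^sup>2" by (intro mult_left_mono) auto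
    moreover have "i\<^sup>2 \<le> k\<^sup>2" using \<open>i \<le> k\<close> by simp
    moreover have "i\<^sup>2 * x\<^sup>2 \<le> k\<^sup>2 * x\<^sup>2" using \<open>i \<le> k\<close> by simp
    ultimately show "(i * x)\<^sup>2 + k\<^sup>2 \<le> (k * x)\<^sup>2 + i\<^sup>2"
      by (simp only: power_mult_distrib diff_mult_distrib mult_1_right)
  next
    fix x :: nat assume "x \<le> 2"
    \<comment> \<open>The growth is \<open>3 * x^2\<close>, which gives the constant 12 at
      \<open>x = 2\<close>.\<close>
    then have "x * x \<le> 2 * 2" by (intro mult_le_mono)
    then show "(x * 2)\<^sup>2 \<le> (x * 1)\<^sup>2 + 12" by (simp add: power2_eq_square)
  qed (simp_all add: power2_eq_square algebra_simps)
  ultimately show ?thesis by auto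
qed

end
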